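(* Let $h$ and $k$ be positive integers and let $q$ be a prime power with $q\ge hk+1$. Then the pseudo-arc $$\mathcal{P}_{h,k,q}=\{X(P_{\alpha}) = X^*(P_{\alpha})\cap\Sigma \;:\; \alpha\in\Lambda_{h,q}\}$$ is non-Desarguesian, that is, there is no Desarguesian $(h-1)$-spread of $\Sigma\simeq\mathrm{PG}(hk-1,q)$ containing all its members.
   Context: $\mathrm{PG}(m-1,q)$ is the $(m-1)$-dimensional projective space over $\mathbb{F}_q$; all dimensions are projective. A pseudo-arc in $\mathrm{PG}(hk-1,q)$ is a set of $(h-1)$-dimensional projective subspaces such that every subset of $k$ of them spans the entire space. $\Sigma\simeq \mathrm{PG}(hk-1,q)$ is the canonical subgeometry of $\mathrm{PG}(hk-1,q^h)$, consisting of the points $\langle(x_1,\dots,x_{hk})\rangle_{\mathbb{F}_{q^h}}$ with $(x_1,\dots,x_{hk})\in\mathbb{F}_q^{hk}\setminus\{0\}$. It is the set of fixed points of the semilinear collineation $\Psi:\langle(x_1,\dots,x_{hk})\rangle_{\mathbb{F}_{q^h}}\mapsto\langle(x_1^q,\dots,x_{hk}^q)\rangle_{\mathbb{F}_{q^h}}$ of $\mathrm{PG}(hk-1,q^h)$, which has order $h$. For a point $P$ of $\mathrm{PG}(hk-1,q^h)$, $X^*(P):=\langle P,P^{\Psi},\dots,P^{\Psi^{h-1}}\rangle_{\mathbb{F}_{q^h}}$ and $X(P):=X^*(P)\cap\Sigma$, regarded as a subspace of $\Sigma$. For $\alpha\in\mathbb{F}_{q^h}$, $P_\alpha:=\langle(1,\alpha,\alpha^2,\dots,\alpha^{hk-1})\rangle_{\mathbb{F}_{q^h}}$.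 $\Lambda_{h,q}$ is a set of representatives of the orbits of size $h$ of $\mathbb{F}_{q^h}$ under the $q$-Frobenius automorphism $x\mapsto x^q$. An $(h-1)$-spread of $\Sigma$ is a set of mutually disjoint $(h-1)$-dimensional subspaces such that every point of $\Sigma$ lies in exactly one of them. Let $\Theta$ be a $(k-1)$-dimensional subspace of $\mathrm{PG}(hk-1,q^h)$ with $\langle\Theta,\Theta^{\Psi},\dots,\Theta^{\Psi^{h-1}}\rangle_{\mathbb{F}_{q^h}}=\mathrm{PG}(hk-1,q^h)$. Then $\mathcal{D}(\Theta):=\{X(P):P\in\Theta\}$ is an $(h-1)$-spread of $\Sigma$. A Desarguesian $(h-1)$-spread of $\Sigma$ is one that is $\mathrm{PGL}(hk,q)$-equivalent to some $\mathcal{D}(\Theta)$.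
   Formalization: Here h and k are at least 2, not just positive: if h = 1 the set of all points of Σ, and if k = 1 the set {Σ}, is a Desarguesian (h-1)-spread containing the pseudo-arc, so the claim fails in exactly those cases. *)

theory Defs
  imports
    "HOL-Analysis.Analysis"
    "HOL-Combinatorics.Orbits"
    "HOL-Number_Theory.Prime_Powers"
begin

text \<open>
  A projective subspace of PG(m-1,F), where m is the size of the index type, is represented by the
  linear subspace of \<^typ>\<open>'a ^ 'n\<close> formed by its representing vectors, so it contains the zero
  vector and its linear dimension is one more than its projective dimension.  In particular a
  projective point is a linear subspace of dimension one.
\<close>

definition proj_subspace :: "nat \<Rightarrow> ('a::field ^ 'n) set \<Rightarrow> bool" where
  "proj_subspace d S \<longleftrightarrow> vec.subspace S \<and> vec.dim S = d + 1"

abbreviation proj_point :: "('a::field ^ 'n) set \<Rightarrow> bool" where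
  "proj_point \<equiv> proj_subspace 0"

definition pseudo_arc :: "nat \<Rightarrow> nat \<Rightarrow> ('a::field ^ 'n) set set \<Rightarrow> bool" where
  "pseudo_arc h k \<A> \<longleftrightarrow> CARD('n) = h * k \<and>
     (\<forall>S\<in>\<A>. proj_subspace (h - 1) S) \<and>
     (\<forall>\<B>. \<B> \<subseteq> \<A> \<and> card \<B> = k \<longrightarrow> vec.span (\<Union>\<B>) = UNIV)"

text \<open>Disjoint projective subspaces have only the zero vector in common.\<close>

definition proj_spread :: "nat \<Rightarrow> ('a::field ^ 'n) set set \<Rightarrow> bool" where
  "proj_spread d \<D> \<longleftrightarrow>
     (\<forall>S\<in>\<D>. proj_subspace d S) \<and>
     (\<forall>S\<in>\<D>. \<forall>T\<in>\<D>. S \<noteq> T \<longrightarrow> S \<inter> T = {0}) \<and>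
     (\<forall>P. proj_point P \<longrightarrow> (\<exists>!S. S \<in> \<D> \<and> P \<subseteq> S))"

text \<open>
  The field with q elements is a type \<^typ>\<open>'f\<close>, its extension of degree h is a type \<^typ>\<open>'e\<close>, and
  the inclusion is a field embedding \<open>\<iota>\<close>.  For finite fields all embeddings have the same image, the
  set of roots of \<open>x ^ q = x\<close>.
\<close>

definition field_embedding :: "('f::field \<Rightarrow> 'e::field) \<Rightarrow> bool" where
  "field_embedding \<iota> \<longleftrightarrow> \<iota> 1 = 1 \<and> (\<forall>x y. \<iota> (x + y) = \<iota> x + \<iota> y) \<and> (\<forall>x y. \<iota> (x * y) = \<iota> x * \<iota> y)"

definition embed_vec :: "('f \<Rightarrow> 'e) \<Rightarrow> 'f ^ 'n \<Rightarrow> 'e ^ 'n" where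
  "embed_vec \<iota> x = (\<chi> i. \<iota> (x $ i))"

text \<open>The collineation acts on projective subspaces by taking the image under this map.\<close>

definition Psi :: "nat \<Rightarrow> 'e::field ^ 'n \<Rightarrow> 'e ^ 'n" where
  "Psi q x = (\<chi> i. (x $ i) ^ q)"

definition conj_span :: "nat \<Rightarrow> nat \<Rightarrow> ('e::field ^ 'n) set \<Rightarrow> ('e ^ 'n) set" where
  "conj_span q h S = vec.span (\<Union>i<h. (Psi q ^^ i) ` S)"

abbreviation X_star :: "nat \<Rightarrow> nat \<Rightarrow> ('e::field ^ 'n) set \<Rightarrow> ('e ^ 'n) set" where
  "X_star q h P \<equiv> conj_span q h P"

text \<open>
  A point of the canonical subgeometry is identified with the point of PG(hk-1,q) spanned by its
  coordinate vector over \<^typ>\<open>'f\<close>.  Under this identification the intersection of a subspace with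
  the subgeometry is the preimage of the subspace under \<^term>\<open>embed_vec \<iota>\<close>.
\<close>

definition X :: "('f \<Rightarrow> 'e::field) \<Rightarrow> nat \<Rightarrow> nat \<Rightarrow> ('e ^ 'n) set \<Rightarrow> ('f ^ 'n) set" where
  "X \<iota> q h P = {x. embed_vec \<iota> x \<in> X_star q h P}"

definition D_spread ::
  "('f \<Rightarrow> 'e::field) \<Rightarrow> nat \<Rightarrow> nat \<Rightarrow> ('e ^ 'n) set \<Rightarrow> ('f ^ 'n) set set" where
  "D_spread \<iota> q h \<Theta> = {X \<iota> q h P | P. proj_point P \<and> P \<subseteq> \<Theta>}"

text \<open>
  Elements of PGL(hk,q) are given by invertible matrices over \<^typ>\<open>'f\<close>, acting on subspaces by image.
\<close>

definition desarguesian_spread ::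
  "('f::field \<Rightarrow> 'e::field) \<Rightarrow> nat \<Rightarrow> nat \<Rightarrow> nat \<Rightarrow> ('f ^ 'n) set set \<Rightarrow> bool" where
  "desarguesian_spread \<iota> q h k \<D> \<longleftrightarrow> proj_spread (h - 1) \<D> \<and>
     (\<exists>\<Theta> :: ('e ^ 'n) set. proj_subspace (k - 1) \<Theta> \<and> conj_span q h \<Theta> = UNIV \<and>
        (\<exists>A :: 'f ^ 'n ^ 'n. invertible A \<and> \<D> = (\<lambda>S. (*v) A ` S) ` D_spread \<iota> q h \<Theta>))"

text \<open>
  The coordinates are numbered by a bijection \<open>idx\<close> from the index type onto \<open>{..<h * k}\<close>.
\<close>

definition P_pt :: "('n \<Rightarrow> nat) \<Rightarrow> 'e::field \<Rightarrow> ('e ^ 'n) set" where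
  "P_pt idx \<alpha> = vec.span {\<chi> i. \<alpha> ^ idx i}"

text \<open>
  The constant \<^const>\<open>orbit\<close> collects the iterates with positive exponent; the Frobenius map of a
  finite field is a permutation of finite order, so this is the whole orbit.
\<close>

definition frobenius_orbit_reps :: "nat \<Rightarrow> nat \<Rightarrow> 'e::field set \<Rightarrow> bool" where
  "frobenius_orbit_reps q h L \<longleftrightarrow>
     (\<forall>\<alpha>\<in>L. card (orbit (\<lambda>x. x ^ q) \<alpha>) = h) \<and>
     (\<forall>x. card (orbit (\<lambda>x. x ^ q) x) = h \<longrightarrow> (\<exists>!\<alpha>. \<alpha> \<in> L \<and> \<alpha> \<in> orbit (\<lambda>x. x ^ q) x))"

definition P_hkq ::
  "('f \<Rightarrow> 'e::field) \<Rightarrow> ('n \<Rightarrow> nat) \<Rightarrow> nat \<Rightarrow> nat \<Rightarrow> 'e set \<Rightarrow> ('f ^ 'n) set set" where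
  "P_hkq \<iota> idx q h L = {X \<iota> q h (P_pt idx \<alpha>) | \<alpha>. \<alpha> \<in> L}"

end

theory Submission
  imports Defs
begin

text \<open>
  Pair vectors of length \<open>n = h * k\<close> by the standard bilinear form.  A vector \<open>f\<close> then is a
  polynomial of degree less than \<open>n\<close>, and its product with the point \<open>pt \<alpha> = (1, \<alpha>, \<alpha>\<^sup>2, \<dots>)\<close> of the
  moment curve is the value of that polynomial at \<open>\<alpha>\<close>.  The space \<open>X_star\<close> of a point is spanned
  over the extension field by the rational vectors that it contains (\<open>span_embed_X\<close>), so \<open>X\<close> and
  \<open>X_star\<close> determine each other and have the same dimension.

  The set is a pseudo-arc because a linear functional over the small field that kills \<open>k\<close> of its
  members is a polynomial of degree less than \<open>n\<close> that vanishes on \<open>k\<close> disjoint Frobenius orbits of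
  size \<open>h\<close>, hence has \<open>n\<close> distinct roots.

  Suppose that the members lie in a Desarguesian spread.  A change of coordinates over the small field
  turns the spread into the one of a subspace \<open>\<Theta>\<close> whose \<open>h\<close> conjugates form a direct sum
  decomposition of the whole space.  Let \<open>M\<close> be the projection onto \<open>\<Theta>\<close> along the other conjugates.
  If \<open>X_star\<close> of \<open>pt \<alpha>\<close> is \<open>X_star\<close> of a point of \<open>\<Theta>\<close>, then it is spanned by a vector fixed by \<open>M\<close> and
  vectors killed by \<open>M\<close>; so \<open>M\<close> maps \<open>pt \<alpha>\<close> into the span of its own conjugates, for every
  \<open>\<alpha>\<close> of full degree.  Read on polynomials: if \<open>f\<close> vanishes at all conjugates of \<open>\<alpha>\<close>, then \<open>f M\<close> vanishes
  at \<open>\<alpha>\<close>.  Apply this to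
  \<open>f = (x - \<alpha>) * (x - \<alpha>^q) * \<dots> * (x - \<alpha>^(q^(h-1))) * g\<close> with a fixed polynomial \<open>g\<close>.
  The value of \<open>f M\<close> at \<open>\<alpha>\<close> is a polynomial in \<open>\<alpha>\<close> of degree smaller than the number of elements of full degree, so it is zero identically (\<open>pairing_vanishes_of_invariant\<close>).

  The hypothesis \<open>q > n\<close> has a further effect: in an identity \<open>A + Y^(q^j) * B = 0\<close> with \<open>A\<close> and \<open>B\<close> of
  degree less than \<open>q^j\<close> both \<open>A\<close> and \<open>B\<close> vanish, so the power \<open>Y^(q^j)\<close> may be replaced by any
  constant.  Replacing the powers one by one (\<open>coeff_pairing_specialize\<close>) gives: if \<open>f\<close> is a product of
  \<open>n - 1\<close> distinct linear factors, then \<open>f M\<close> vanishes at every root of \<open>f\<close>, and so \<open>f M\<close> is a multiple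
  of \<open>f\<close> (\<open>left_eigenvector_of_invariant\<close>).

  Finally choose the roots in the small field, which has at least \<open>n - 1\<close> elements.  An eigenvector \<open>f\<close>
  of a projection annihilates its image \<open>\<Theta>\<close> or its kernel, and the kernel contains a conjugate of
  \<open>\<Theta>\<close>.  As \<open>f\<close> is fixed by Frobenius, it annihilates all conjugates of \<open>\<Theta>\<close>, that is, the whole
  space.  But \<open>f\<close> is not zero.
\<close>

section \<open>Linear algebra\<close>

lemma scalar_product_add_right:
  "scalar_product f (x + y) = scalar_product f x + scalar_product f (y :: 'a::comm_ring_1 ^ 'n)"
  by (simp add: scalar_product_def sum.distrib algebra_simps)

lemma scalar_product_scale_right:
  "scalar_product f (c *s x) = c * scalar_product f (x :: 'a::comm_ring_1 ^ 'n)"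
  by (simp add: scalar_product_def sum_distrib_left algebra_simps)

lemma scalar_product_zero_right [simp]:
  "scalar_product f (0 :: 'a::comm_ring_1 ^ 'n) = 0"
  by (simp add: scalar_product_def)

lemma scalar_product_scale_left:
  "scalar_product (c *s f) x = c * scalar_product f (x :: 'a::comm_ring_1 ^ 'n)"
  by (simp add: scalar_product_def sum_distrib_left algebra_simps)

lemma scalar_product_sum_right:
  "scalar_product f (\<Sum>i\<in>I. x i) = (\<Sum>i\<in>I. scalar_product f (x i :: 'a::comm_ring_1 ^ 'n))"
  by (induction I rule: infinite_finite_induct) (auto simp: scalar_product_add_right)

lemma scalar_product_vector_matrix:
  "scalar_product (f v* M) x = scalar_product f (M *v (x :: 'a::comm_ring_1 ^ 'n))"
proof -
  have "scalar_product (f v* M) x = (\<Sum>j\<in>UNIV. \<Sum>i\<in>UNIV. f $ i * M $ i $ j * x $ j)"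
    by (simp add: scalar_product_def vector_matrix_mult_def sum_distrib_right)
  also have "\<dots> = (\<Sum>i\<in>UNIV. \<Sum>j\<in>UNIV. f $ i * M $ i $ j * x $ j)"
    by (rule sum.swap)
  also have "\<dots> = scalar_product f (M *v x)"
    by (simp add: scalar_product_def matrix_vector_mult_def sum_distrib_left mult.assoc)
  finally show ?thesis .
qed

lemma scalar_product_zero_on_span:
  fixes f :: "'a::field ^ 'n"
  assumes "x \<in> vec.span S" "\<And>s. s \<in> S \<Longrightarrow> scalar_product f s = 0"
  shows "scalar_product f x = 0"
  using assms(1)
  by (induction rule: vec.span_induct_alt)
     (auto simp: scalar_product_add_right scalar_product_scale_right assms(2))

text \<open>
  A basis of \<open>S\<close> together with \<open>x\<close> is independent, so there is a linear map that kills \<open>S\<close> and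
  not \<open>x\<close>; the functional is one coordinate of that map.
\<close>

lemma separating_functional:
  fixes S :: "('a::field ^ 'n) set"
  assumes "x \<notin> vec.span S"
  obtains f where "\<And>s. s \<in> S \<Longrightarrow> scalar_product f s = 0" and "scalar_product f x \<noteq> 0"
proof -
  obtain B where B: "B \<subseteq> S" "vec.independent B" "S \<subseteq> vec.span B"
    using vec.maximal_independent_subset by blast
  have xB: "x \<notin> vec.span B"
    using assms B(1) vec.span_mono by blast
  then have "vec.independent (insert x B)"
    using B(2) by (simp add: vec.independent_insertI)
  then obtain g :: "'a ^ 'n \<Rightarrow> 'a ^ 'n" where
    g: "Vector_Spaces.linear (*s) (*s) g"
       "\<forall>b\<in>insert x B. g b = (if b = x then (\<chi> i. 1) else 0)"
    using vec.linear_independent_extend[of "insert x B" "\<lambda>b. if b = x then (\<chi> i. 1) else 0"] by blast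
  obtain j :: 'n where True by simp
  define f where "f = (\<chi> i. g (axis i 1) $ j)"
  have f: "scalar_product f y = g y $ j" for y
    using linear_componentwise[OF g(1), of y j]
    by (simp add: scalar_product_def f_def mult.commute)
  have "x \<notin> B"
    using xB vec.span_base by blast
  then have fB: "scalar_product f b = 0" if "b \<in> B" for b
    using g(2) that by (auto simp: f)
  have "scalar_product f s = 0" if "s \<in> S" for s
    using B(3) that fB by (blast intro: scalar_product_zero_on_span)
  moreover have "scalar_product f x \<noteq> 0"
    using g(2) by (simp add: f)
  ultimately show ?thesis
    using that by blast
qed

lemma scalar_product_nondegenerate:
  fixes f :: "'a::field ^ 'n"
  assumes "\<And>x. scalar_product f x = 0"
  shows "f = 0"
proof -
  have "f $ i = 0" for i
    using assms[of "axis i 1"] by (simp add: scalar_product_def axis_def if_distrib cong: if_cong)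
  then show ?thesis
    by (simp add: vec_eq_iff)
qed

section \<open>Finite fields and the Frobenius map\<close>

text \<open>
  Multiplication by a nonzero \<open>x\<close> permutes the nonzero elements, so it does not change their product.
\<close>

lemma finite_field_power_card:
  "x ^ CARD('a) = (x :: 'a::{field,finite})"
proof (cases "x = 0")
  case False
  have "bij_betw ((*) x) (UNIV - {0}) (UNIV - {0})"
    by (rule bij_betwI[where g = "\<lambda>y. y / x"]) (use False in auto)
  then have "(\<Prod>y\<in>UNIV-{0}. x * y) = \<Prod>(UNIV - {0 :: 'a})"
    using prod.reindex_bij_betw[of "(*) x" _ _ "\<lambda>y. y"] by blast
  then have "x ^ (CARD('a) - 1) = 1"
    by (simp add: prod.distrib)
  moreover have "CARD('a) = Suc (CARD('a) - 1)"
    by simp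
  ultimately show ?thesis
    by (metis mult.right_neutral power_Suc)
qed simp

lemma card_power_eq_self_le:
  assumes "m > 1"
  shows "finite {x :: 'a::field. x ^ m = x}" and "card {x :: 'a::field. x ^ m = x} \<le> m"
proof -
  let ?p = "monom (1 :: 'a) m - monom 1 1"
  have deg: "degree ?p \<le> m"
    using assms by (intro degree_diff_le) (auto simp: degree_monom_eq)
  have "coeff ?p m = 1"
    using assms by simp
  then have p: "?p \<noteq> 0"
    by (metis coeff_0 zero_neq_one)
  have eq: "{x :: 'a. x ^ m = x} = {x. poly ?p x = 0}"
    by (simp add: poly_monom)
  show "finite {x :: 'a. x ^ m = x}"
    unfolding eq using p by (rule poly_roots_finite)
  show "card {x :: 'a. x ^ m = x} \<le> m"
    unfolding eq using card_poly_roots_bound[OF p] deg by linarith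
qed

text \<open>
  The standing situation: \<open>\<iota>\<close> embeds the field with \<open>q\<close> elements into its extension of degree \<open>h\<close>.
\<close>

locale frobenius_extension =
  fixes \<iota> :: "'f::{field,finite} \<Rightarrow> 'e::{field,finite}" and q h :: nat
  assumes primepow_q: "primepow q" and h_pos: "h \<ge> 1"
    and card_base: "CARD('f) = q" and card_ext: "CARD('e) = q ^ h"
    and embedding: "field_embedding \<iota>"
begin

lemma q_gt_1: "q > 1"
  using primepow_gt_Suc_0[OF primepow_q] by simp

lemma q_power_of_CHAR: "\<exists>m. q = CHAR('e) ^ m"
proof -
  obtain p m where pm: "prime p" "q = p ^ m"
    using primepow_q unfolding primepow_def by auto
  \<comment> \<open>The translation by 1 permutes the field, so the order of the field is zero in the field.\<close>
  have "(\<Sum>x\<in>UNIV. x + 1 :: 'e) = \<Sum>UNIV"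
    by (rule sum.reindex_bij_witness[of _ "\<lambda>x. x - 1" "\<lambda>x. x + 1"]) auto
  then have "of_nat CARD('e) = (0 :: 'e)"
    by (simp add: sum.distrib)
  then have "CHAR('e) dvd p ^ (m * h)"
    by (simp only: of_nat_eq_0_iff_char_dvd card_ext pm(2) power_mult)
  moreover have "prime CHAR('e)"
    by (intro prime_CHAR_semidom finite_imp_CHAR_pos) simp
  ultimately have "CHAR('e) = p"
    using pm(1) prime_dvd_power primes_dvd_imp_eq by blast
  then show ?thesis
    using pm(2) by auto
qed

lemma prime_CHAR_ext: "prime CHAR('e)"
  by (intro prime_CHAR_semidom finite_imp_CHAR_pos) simp

lemma frob_add: "(x + y :: 'e) ^ q = x ^ q + y ^ q"
  using freshmans_dream'[OF prime_CHAR_ext] q_power_of_CHAR by blast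

lemma frob_sum: "(\<Sum>i\<in>I. f i :: 'e) ^ q = (\<Sum>i\<in>I. f i ^ q)"
  using freshmans_dream_sum'[OF prime_CHAR_ext] q_power_of_CHAR by blast

lemma frob_minus: "(- x :: 'e) ^ q = - (x ^ q)"
proof -
  have "x ^ q + (- x) ^ q = 0"
    using q_gt_1 by (simp flip: frob_add)
  then show ?thesis
    by (simp add: add_eq_0_iff)
qed

lemma frob_h: "x ^ (q ^ h) = (x :: 'e)"
  using finite_field_power_card[of x] by (simp add: card_ext)

lemma frob_inj: "x ^ q = y ^ q \<longleftrightarrow> x = (y :: 'e)"
proof
  assume "x ^ q = y ^ q"
  then have "(x ^ q) ^ (q ^ (h - 1)) = (y ^ q) ^ (q ^ (h - 1))"
    by simp
  moreover have "q * q ^ (h - 1) = q ^ h"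
    using h_pos by (metis One_nat_def Suc_pred' less_eq_Suc_le power_Suc)
  ultimately show "x = y"
    by (simp flip: power_mult add: frob_h)
qed simp

lemma frob_iter_inj: "x ^ (q ^ i) = y ^ (q ^ i) \<longleftrightarrow> x = (y :: 'e)"
  by (induction i) (simp_all add: power_mult frob_inj mult.commute[of q])

lemma frob_power_mod: "x ^ (q ^ (m mod h)) = (x :: 'e) ^ (q ^ m)"
proof -
  have *: "x ^ (q ^ (h * n)) = x" for n
    by (induction n) (simp_all add: power_add power_mult[of x] frob_h)
  have "x ^ (q ^ m) = x ^ (q ^ (h * (m div h) + m mod h))"
    by simp
  also have "\<dots> = x ^ (q ^ (m mod h))"
    unfolding power_add power_mult[of x] * ..
  finally show ?thesis ..
qed

lemma embed_1 [simp]: "\<iota> 1 = 1" and embed_add: "\<iota> (x + y) = \<iota> x + \<iota> y"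
  and embed_mult: "\<iota> (x * y) = \<iota> x * \<iota> y"
  using embedding by (auto simp: field_embedding_def)

lemma embed_0 [simp]: "\<iota> 0 = 0"
  using embed_add[of 0 0] by (metis add_0_right add_left_cancel)

lemma embed_power: "\<iota> (x ^ n) = \<iota> x ^ n"
  by (induction n) (simp_all add: embed_mult)

lemma embed_sum: "\<iota> (\<Sum>i\<in>I. f i) = (\<Sum>i\<in>I. \<iota> (f i))"
  by (induction I rule: infinite_finite_induct) (simp_all add: embed_add)

lemma embed_eq_0_iff: "\<iota> x = 0 \<longleftrightarrow> x = 0"
proof
  assume "\<iota> x = 0"
  show "x = 0"
  proof (rule ccontr)
    assume "x \<noteq> 0"
    then have "\<iota> x * \<iota> (inverse x) = 1"
      by (simp flip: embed_mult)
    with \<open>\<iota> x = 0\<close> show False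
      by simp
  qed
qed simp

lemma inj_embed: "inj \<iota>"
proof (rule injI)
  fix x y assume "\<iota> x = \<iota> y"
  moreover have "\<iota> x = \<iota> (x - y) + \<iota> y"
    by (simp flip: embed_add)
  ultimately show "x = y"
    by (simp add: embed_eq_0_iff)
qed

text \<open>
  The image of \<open>\<iota>\<close> consists of \<open>q\<close> roots of \<open>x ^ q = x\<close>, and there are no more than \<open>q\<close>.
\<close>

lemma fixed_iff_range: "x ^ q = x \<longleftrightarrow> x \<in> range \<iota>"
proof -
  have sub: "range \<iota> \<subseteq> {x. x ^ q = x}"
    using finite_field_power_card[where ?'a = 'f] by (auto simp: card_base simp flip: embed_power)
  have "range \<iota> = {x. x ^ q = x}"
    using card_power_eq_self_le[OF q_gt_1, where ?'a = 'e] inj_embed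
    by (intro card_subset_eq[OF _ sub] antisym card_mono[OF _ sub])
       (auto simp: card_image card_base)
  then show ?thesis
    by blast
qed

section \<open>Vectors over the extension field\<close>

lemma Psi_iter: "(Psi q ^^ i) x = (\<chi> j. (x $ j) ^ (q ^ i))"
  by (induction i) (simp_all add: Psi_def vec_eq_iff mult.commute[of q] flip: power_mult)

lemma Psi_iter_add: "(Psi q ^^ i) (x + y :: 'e ^ 'n) = (Psi q ^^ i) x + (Psi q ^^ i) y"
  by (induction i) (simp_all add: Psi_def vec_eq_iff frob_add)

lemma Psi_iter_scale: "(Psi q ^^ i) (c *s x :: 'e ^ 'n) = c ^ (q ^ i) *s (Psi q ^^ i) x"
  by (simp add: Psi_iter vec_eq_iff power_mult_distrib)

lemma Psi_iter_0: "(Psi q ^^ i) (0 :: 'e ^ 'n) = 0"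
  using Psi_iter_add[of i 0 0] by simp

lemma Psi_iter_mod: "(Psi q ^^ (m mod h)) (x :: 'e ^ 'n) = (Psi q ^^ m) x"
  by (simp add: Psi_iter frob_power_mod)

lemma Psi_iter_span:
  assumes "x \<in> vec.span (S :: ('e ^ 'n) set)"
  shows "(Psi q ^^ i) x \<in> vec.span ((Psi q ^^ i) ` S)"
  using assms
proof (induction rule: vec.span_induct_alt)
  case base
  then show ?case by (simp add: Psi_iter_0 vec.span_zero)
next
  case (step c x y)
  then show ?case
    by (simp add: Psi_iter_add Psi_iter_scale vec.span_add vec.span_scale vec.span_base)
qed

lemma conj_span_span: "conj_span q h (vec.span S :: ('e ^ 'n) set) = conj_span q h S"
proof -
  have "(Psi q ^^ i) ` vec.span S \<subseteq> vec.span (\<Union>i<h. (Psi q ^^ i) ` S)" if "i < h" for i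
  proof -
    have "(Psi q ^^ i) ` vec.span S \<subseteq> vec.span ((Psi q ^^ i) ` S)"
      using Psi_iter_span by blast
    also have "\<dots> \<subseteq> vec.span (\<Union>i<h. (Psi q ^^ i) ` S)"
      using that by (intro vec.span_mono) blast
    finally show ?thesis .
  qed
  then have "(\<Union>i<h. (Psi q ^^ i) ` vec.span S) \<subseteq> vec.span (\<Union>i<h. (Psi q ^^ i) ` S)"
    by blast
  moreover have "(\<Union>i<h. (Psi q ^^ i) ` S) \<subseteq> (\<Union>i<h. (Psi q ^^ i) ` vec.span S)"
    by (intro UN_mono image_mono vec.span_superset) auto
  ultimately show ?thesis
    unfolding conj_span_def by (metis vec.span_mono vec.span_span subset_antisym)
qed

lemma X_star_point: "X_star q h (vec.span {w :: 'e ^ 'n}) = vec.span ((\<lambda>i. (Psi q ^^ i) w) ` {..<h})"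
  unfolding conj_span_span by (simp add: conj_span_def UNION_singleton_eq_range)

text \<open>
  The conjugates of a conjugate of \<open>w\<close> are those of \<open>w\<close>, since \<open>Psi q\<close> has order dividing \<open>h\<close>.
\<close>

lemma X_star_Psi_iter:
  "X_star q h (vec.span {(Psi q ^^ j) w}) = X_star q h (vec.span {w :: 'e ^ 'n})"
proof -
  have eq: "(\<lambda>i. (Psi q ^^ i) w) ` {..<h} = range (\<lambda>i. (Psi q ^^ i) w)" for w :: "'e ^ 'n"
  proof -
    have "(Psi q ^^ i) w \<in> (\<lambda>i. (Psi q ^^ i) w) ` {..<h}" for i
      using h_pos by (intro image_eqI[of _ _ "i mod h"]) (auto simp: Psi_iter_mod)
    then show ?thesis
      by auto
  qed
  have "(Psi q ^^ i) w = (Psi q ^^ (i + j * (h - 1))) ((Psi q ^^ j) w)" for i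
  proof -
    have "(i + j * (h - 1) + j) = i + j * h"
      using h_pos by (cases h) auto
    then have "(Psi q ^^ (i + j * (h - 1))) ((Psi q ^^ j) w) = (Psi q ^^ (i + j * h)) w"
      by (metis comp_apply funpow_add)
    also have "\<dots> = (Psi q ^^ i) w"
      by (metis Psi_iter_mod mod_mult_self1)
    finally show ?thesis ..
  qed
  then have "range (\<lambda>i. (Psi q ^^ i) w) \<subseteq> range (\<lambda>i. (Psi q ^^ i) ((Psi q ^^ j) w))"
    by blast
  moreover have "range (\<lambda>i. (Psi q ^^ i) ((Psi q ^^ j) w)) \<subseteq> range (\<lambda>i. (Psi q ^^ i) w)"
    by (auto simp flip: funpow_add[THEN fun_cong, unfolded comp_apply])
  ultimately have "range (\<lambda>i. (Psi q ^^ i) ((Psi q ^^ j) w)) = range (\<lambda>i. (Psi q ^^ i) w)"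
    by (rule subset_antisym[rotated])
  then show ?thesis
    by (simp only: X_star_point eq)
qed

lemma embed_vec_add: "embed_vec \<iota> (x + y) = embed_vec \<iota> x + embed_vec \<iota> y"
  by (simp add: embed_vec_def vec_eq_iff embed_add)

lemma embed_vec_scale: "embed_vec \<iota> (c *s x) = \<iota> c *s embed_vec \<iota> x"
  by (simp add: embed_vec_def vec_eq_iff embed_mult)

lemma embed_vec_0: "embed_vec \<iota> 0 = 0"
  by (simp add: embed_vec_def vec_eq_iff)

lemma inj_embed_vec: "inj (embed_vec \<iota> :: 'f ^ 'n \<Rightarrow> 'e ^ 'n)"
  using inj_embed by (auto simp: inj_def embed_vec_def vec_eq_iff)

lemma fixed_iff_range_vec: "Psi q y = y \<longleftrightarrow> y \<in> range (embed_vec \<iota>)"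
proof
  assume "Psi q y = y"
  then have "y $ i \<in> range \<iota>" for i
    by (simp add: Psi_def vec_eq_iff flip: fixed_iff_range)
  then have "y = embed_vec \<iota> (\<chi> i. inv \<iota> (y $ i))"
    by (simp add: embed_vec_def vec_eq_iff f_inv_into_f)
  then show "y \<in> range (embed_vec \<iota>)"
    by blast
next
  assume "y \<in> range (embed_vec \<iota>)"
  then show "Psi q y = y"
    using fixed_iff_range by (auto simp: Psi_def vec_eq_iff embed_vec_def)
qed

lemma scalar_product_embed_vec:
  "scalar_product (embed_vec \<iota> f) (embed_vec \<iota> x) = \<iota> (scalar_product f x)"
  by (simp add: scalar_product_def embed_vec_def embed_sum embed_mult)

lemma scalar_product_Psi: "scalar_product (Psi q f) (Psi q x) = scalar_product f (x :: 'e ^ 'n) ^ q"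
  by (simp add: scalar_product_def Psi_def frob_sum power_mult_distrib)

lemma embed_vec_span:
  assumes "x \<in> vec.span S"
  shows "embed_vec \<iota> x \<in> vec.span (embed_vec \<iota> ` S)"
  using assms
proof (induction rule: vec.span_induct_alt)
  case base
  then show ?case by (simp add: embed_vec_0 vec.span_zero)
next
  case (step c x y)
  then show ?case
    by (simp add: embed_vec_add embed_vec_scale vec.span_add vec.span_scale vec.span_base)
qed

text \<open>
  A basis over the small field of the whole space still generates the standard basis after
  embedding, and by its size it remains independent.  Hence independence of rational vectors does not
  depend on the field.
\<close>

lemma dim_embed_vec: "vec.dim (embed_vec \<iota> ` S) = vec.dim (S :: ('f ^ 'n) set)"
proof -
  obtain B where B: "B \<subseteq> S" "vec.independent B" "S \<subseteq> vec.span B"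
    using vec.maximal_independent_subset by blast
  obtain C where C: "B \<subseteq> C" "vec.independent C" "vec.span C = UNIV"
    using vec.maximal_independent_subset_extend[OF subset_UNIV B(2)] by (metis top.extremum_uniqueI)
  have finC: "finite C"
    using C(2) by (rule vec.finiteI_independent)
  have cardC: "card C = CARD('n)"
    by (metis C(2,3) vec.dim_eq_card_independent vec.dim_span vec_dim_card)
  have inj: "inj_on (embed_vec \<iota>) A" for A :: "('f ^ 'n) set"
    using inj_embed_vec by (rule inj_on_subset) simp
  have "vec.span (embed_vec \<iota> ` C) = UNIV"
  proof -
    have "cart_basis \<subseteq> vec.span (embed_vec \<iota> ` C)"
    proof
      fix y :: "'e ^ 'n"
      assume "y \<in> cart_basis"
      then obtain i where "y = axis i 1"
        by (auto simp: cart_basis_def)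
      then have "y = embed_vec \<iota> (axis i 1)"
        by (simp add: embed_vec_def axis_def vec_eq_iff)
      then show "y \<in> vec.span (embed_vec \<iota> ` C)"
        using embed_vec_span[of "axis i 1" C] C(3) by simp
    qed
    then show ?thesis
      by (metis span_cart_basis vec.span_mono vec.span_span top.extremum_uniqueI)
  qed
  moreover have "card (embed_vec \<iota> ` C) = CARD('n)"
    by (simp add: card_image inj cardC)
  ultimately have "vec.independent (embed_vec \<iota> ` C)"
    using finC by (intro vec.card_le_dim_spanning[of _ UNIV]) (simp_all add: card_cart_basis)
  then have "vec.independent (embed_vec \<iota> ` B)"
    using C(1) by (meson image_mono vec.independent_mono)
  moreover have "embed_vec \<iota> ` S \<subseteq> vec.span (embed_vec \<iota> ` B)"
    using B(3) embed_vec_span by blast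
  ultimately have "vec.dim (embed_vec \<iota> ` S) = card (embed_vec \<iota> ` B)"
    using B(1) by (intro vec.dim_unique) auto
  also have "\<dots> = vec.dim S"
    using B by (simp add: card_image inj vec.basis_card_eq_dim)
  finally show ?thesis .
qed

text \<open>
  The traces \<open>trace c\<close> of the multiples of \<open>w\<close> are rational.  If a functional kills them all, then
  the values of the functional at the conjugates of \<open>w\<close> are the coefficients of a polynomial in \<open>c\<close> that
  vanishes on the whole field; its degree is at most \<open>q ^ (h - 1)\<close>, so these values are zero.  Thus the
  traces already span all conjugates.
\<close>

lemma span_embed_X:
  fixes w :: "'e ^ 'n"
  shows "vec.span (embed_vec \<iota> ` X \<iota> q h (vec.span {w})) = X_star q h (vec.span {w})"
    (is "?L = ?R")
proof
  have "embed_vec \<iota> ` X \<iota> q h (vec.span {w}) \<subseteq> ?R"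
    by (auto simp: X_def)
  then show "?L \<subseteq> ?R"
    by (metis X_star_point vec.span_mono vec.span_span)
next
  define trace where "trace c = (\<Sum>i<h. c ^ (q ^ i) *s (Psi q ^^ i) w)" for c :: 'e
  have trace_in: "trace c \<in> embed_vec \<iota> ` X \<iota> q h (vec.span {w})" for c
  proof -
    have "Psi q (trace c) = trace c"
    proof -
      have "Psi q (trace c) = (\<Sum>i<h. c ^ (q ^ Suc i) *s (Psi q ^^ Suc i) w)"
        by (simp add: trace_def Psi_def Psi_iter vec_eq_iff frob_sum power_mult_distrib
              mult.commute[of q] flip: power_mult)
      also have "\<dots> = (\<Sum>i\<in>{1..<Suc h}. c ^ (q ^ i) *s (Psi q ^^ i) w)"
        by (simp only: sum.shift_bounds_Suc_ivl lessThan_atLeast0 One_nat_def)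
      also have "\<dots> = (\<Sum>i\<in>{1..<h}. c ^ (q ^ i) *s (Psi q ^^ i) w) + c *s w"
        using h_pos Psi_iter_mod[of h w] by (simp add: frob_h)
      also have "\<dots> = trace c"
        unfolding trace_def lessThan_atLeast0 using h_pos
        by (subst (2) sum.atLeast_Suc_lessThan) simp_all
      finally show ?thesis .
    qed
    then obtain x where x: "trace c = embed_vec \<iota> x"
      using fixed_iff_range_vec by blast
    have "trace c \<in> ?R"
      unfolding X_star_point trace_def by (intro vec.span_sum vec.span_scale vec.span_base) auto
    with x show ?thesis
      by (auto simp: X_def)
  qed
  have "(Psi q ^^ i) w \<in> ?L" if "i < h" for i
  proof (rule ccontr)
    assume "(Psi q ^^ i) w \<notin> ?L"
    then obtain f where f: "\<And>s. s \<in> embed_vec \<iota> ` X \<iota> q h (vec.span {w}) \<Longrightarrow> scalar_product f s = 0"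
      "scalar_product f ((Psi q ^^ i) w) \<noteq> 0"
      using separating_functional by blast
    define p where "p = (\<Sum>i<h. monom (scalar_product f ((Psi q ^^ i) w)) (q ^ i))"
    have "poly p c = scalar_product f (trace c)" for c
      by (simp add: p_def trace_def poly_sum poly_monom scalar_product_sum_right
            scalar_product_scale_right mult.commute)
    then have zero: "poly p c = 0" for c
      using f(1) trace_in by simp
    have "degree p \<le> q ^ (h - 1)"
      unfolding p_def using q_gt_1
      by (intro degree_sum_le order.trans[OF degree_monom_le] power_increasing) auto
    also have "\<dots> < q ^ h"
      using q_gt_1 h_pos by (intro power_strict_increasing) auto
    finally have "p = 0"
      using zero by (intro poly_eqI_degree[of UNIV]) (use q_gt_1 in \<open>auto simp: card_ext\<close>)
    moreover have "coeff p (q ^ i) = scalar_product f ((Psi q ^^ i) w)"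
    proof -
      have "coeff p (q ^ i) = (\<Sum>j<h. if j = i then scalar_product f ((Psi q ^^ j) w) else 0)"
        using q_gt_1 by (auto simp: p_def coeff_sum intro!: sum.cong)
      then show ?thesis
        using that by simp
    qed
    ultimately show False
      using f(2) by simp
  qed
  then have "(\<lambda>i. (Psi q ^^ i) w) ` {..<h} \<subseteq> ?L"
    by blast
  then show "?R \<subseteq> ?L"
    by (metis X_star_point vec.span_mono vec.span_span)
qed

lemma subspace_X: "vec.subspace (X \<iota> q h P)"
  unfolding X_def conj_span_def
  by (auto simp: vec.subspace_def embed_vec_0 embed_vec_add embed_vec_scale
      intro: vec.span_zero vec.span_add vec.span_scale)

lemma dim_X: "vec.dim (X \<iota> q h (vec.span {w :: 'e ^ 'n})) = vec.dim (X_star q h (vec.span {w}))"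
  by (metis dim_embed_vec span_embed_X vec.dim_span)

end

section \<open>Polynomials with prescribed roots\<close>

definition poly_of_roots :: "'a::comm_ring_1 list \<Rightarrow> 'a poly" where
  "poly_of_roots as = (\<Prod>a\<leftarrow>as. [:- a, 1:])"

lemma poly_of_roots_simps [simp]:
  "poly_of_roots [] = 1"
  "poly_of_roots (a # as) = [:- a, 1:] * poly_of_roots as"
  "poly_of_roots (as @ bs) = poly_of_roots as * poly_of_roots bs"
  by (simp_all add: poly_of_roots_def)

lemma degree_poly_of_roots:
  fixes as :: "'a::idom list"
  shows "poly_of_roots as \<noteq> 0 \<and> degree (poly_of_roots as) = length as"
proof (induction as)
  case (Cons a as)
  then show ?case by (auto simp: degree_mult_eq simp del: mult_pCons_left)
qed simp

lemma lead_coeff_poly_of_roots: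
  fixes as :: "'a::idom list"
  shows "coeff (poly_of_roots as) (length as) = 1"
proof -
  have "lead_coeff (poly_of_roots as) = 1"
    by (induction as) (auto simp: lead_coeff_mult simp del: mult_pCons_left)
  then show ?thesis
    by (simp add: degree_poly_of_roots)
qed

lemma poly_poly_of_roots_eq_0_iff:
  fixes as :: "'a::idom list"
  shows "poly (poly_of_roots as) x = 0 \<longleftrightarrow> x \<in> set as"
  by (induction as) (auto simp del: mult_pCons_left)

lemma poly_of_roots_remove1:
  "a \<in> set as \<Longrightarrow> poly_of_roots as = poly_of_roots (a # remove1 a as)"
  by (induction as) (auto simp: mult.left_commute simp del: mult_pCons_left mult_pCons_right)

lemma coeff_linear_mult:
  "coeff ([:- a, 1:] * p) n = (case n of 0 \<Rightarrow> 0 | Suc m \<Rightarrow> coeff p m) - a * coeff (p :: 'a::comm_ring_1 poly) n"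
  by (cases n) (simp_all add: algebra_simps)

lemma poly_coeff_poly_of_roots:
  fixes as :: "'a::comm_ring_1 poly list"
  shows "poly (coeff (poly_of_roots as) n) c = coeff (poly_of_roots (map (\<lambda>a. poly a c) as)) n"
  by (induction as arbitrary: n)
     (auto simp: coeff_linear_mult coeff_1 split: nat.split simp del: mult_pCons_left)

text \<open>
  For a polynomial in \<open>x\<close> with coefficients in polynomials in \<open>Y\<close>: the degree in \<open>Y\<close>.
\<close>

lemma degree_coeff_poly_of_roots:
  fixes as :: "'a::idom poly list"
  shows "degree (coeff (poly_of_roots as) n) \<le> (\<Sum>a\<leftarrow>as. degree a)"
proof (induction as arbitrary: n)
  case (Cons a as)
  have "degree (case n of 0 \<Rightarrow> 0 | Suc m \<Rightarrow> coeff (poly_of_roots as) m) \<le> degree a + (\<Sum>a\<leftarrow>as. degree a)"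
    using Cons.IH by (auto split: nat.split intro: trans_le_add2)
  moreover have "degree (a * coeff (poly_of_roots as) n) \<le> degree a + (\<Sum>a\<leftarrow>as. degree a)"
    using Cons.IH[of n] by (intro order.trans[OF degree_mult_le]) simp
  ultimately show ?case
    by (simp add: coeff_linear_mult degree_diff_le del: mult_pCons_left)
qed (simp add: coeff_1)

section \<open>Specializing Frobenius powers of a variable\<close>

text \<open>
  A linear functional on polynomials given by weights \<open>w\<close>, of which only the coefficients in the
  range of \<open>idx\<close> count.  Below, the scalars are polynomials in \<open>Y\<close>, and the roots of the polynomial paired
  with \<open>w\<close> are constants or powers of \<open>Y\<close>.
\<close>

definition coeff_pairing :: "('n::finite \<Rightarrow> nat) \<Rightarrow> ('n \<Rightarrow> 'a) \<Rightarrow> 'a::comm_ring_1 poly \<Rightarrow> 'a" where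
  "coeff_pairing idx w p = (\<Sum>j\<in>UNIV. coeff p (idx j) * w j)"

lemma coeff_pairing_linear_factor:
  "coeff_pairing idx w ([:- a, 1:] * p) =
     coeff_pairing idx w ([:0, 1:] * p) - a * coeff_pairing idx w p"
  by (simp add: coeff_pairing_def sum_subtractf sum_distrib_left algebra_simps)

lemma degree_coeff_pairing:
  assumes "\<And>i. degree (coeff p i) \<le> d" and "\<And>j. degree (w j) \<le> m"
  shows "degree (coeff_pairing idx w p) \<le> d + m"
  unfolding coeff_pairing_def
  by (intro degree_sum_le order.trans[OF degree_mult_le] add_mono assms) simp

text \<open>
  The pairing has the form \<open>A - Y ^ s * B\<close> with \<open>A\<close> and \<open>B\<close> of degree less than \<open>s\<close>.  If it vanishes,
  then \<open>A = B = 0\<close>, and \<open>A - c * B\<close> vanishes for every \<open>c\<close>.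
\<close>

lemma coeff_pairing_replace_root:
  fixes p :: "'a::idom poly poly"
  assumes deg: "\<And>i. degree (coeff p i) \<le> d" "\<And>j. degree (w j) \<le> m" "d + m < s"
    and zero: "coeff_pairing idx w ([:- monom 1 s, 1:] * p) = 0"
  shows "coeff_pairing idx w ([:- c, 1:] * p) = 0"
proof -
  have eq: "coeff_pairing idx w ([:0, 1:] * p) = monom 1 s * coeff_pairing idx w p"
    using zero by (simp only: coeff_pairing_linear_factor) simp
  have "degree (coeff ([:0, 1:] * p) i) \<le> d" for i
    using deg(1) by (cases i) auto
  then have "degree (coeff_pairing idx w ([:0, 1:] * p)) < s"
    using degree_coeff_pairing[of "[:0, 1:] * p" d w m idx] deg(2,3) by (meson le_less_trans)
  then have "coeff_pairing idx w p = 0"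
    unfolding eq by (cases "coeff_pairing idx w p = 0") (auto simp: degree_mult_eq degree_monom_eq)
  then show ?thesis
    using eq by (simp only: coeff_pairing_linear_factor) simp
qed

lemma sum_powers_lt:
  assumes "q \<ge> (2::nat)"
  shows "(\<Sum>i\<leftarrow>[0..<Suc j]. q ^ i) + (q - 2) < q ^ Suc j"
proof (induction j)
  case (Suc j)
  have "2 * q ^ Suc j \<le> q ^ Suc (Suc j)"
    using assms by simp
  moreover have "(\<Sum>i\<leftarrow>[0..<Suc (Suc j)]. q ^ i) = (\<Sum>i\<leftarrow>[0..<Suc j]. q ^ i) + q ^ Suc j"
    by simp
  ultimately show ?case
    using Suc by linarith
qed (use assms in simp)

text \<open>
  The roots \<open>Y ^ (q ^ j), \<dots>, Y ^ q\<close> are replaced by constants in this order, the highest power first: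
  the remaining powers have total degree \<open>1 + q + \<dots> + q ^ (j - 1)\<close>, which together with the degree of the
  weights is less than \<open>q ^ j\<close>.  The root \<open>Y\<close> is kept.
\<close>

lemma coeff_pairing_specialize:
  fixes w :: "'n::finite \<Rightarrow> 'a::idom poly"
  assumes "q \<ge> 2" and deg: "\<And>j. degree (w j) \<le> q - 2"
    and "coeff_pairing idx w (poly_of_roots (map (\<lambda>i. monom 1 (q ^ i)) [0..<Suc j] @ map (\<lambda>c. [:c:]) ds)) = 0"
    and "length cs = j"
  shows "coeff_pairing idx w (poly_of_roots (monom 1 1 # map (\<lambda>c. [:c:]) (cs @ ds))) = 0"
  using assms(3,4)
proof (induction j arbitrary: cs ds)
  case (Suc j)
  obtain cs' c where cs: "cs = cs' @ [c]" "length cs' = j"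
    using Suc.prems(2) by (metis length_Suc_conv_rev)
  let ?as = "map (\<lambda>i. monom (1 :: 'a) (q ^ i)) [0..<Suc j] @ map (\<lambda>c. [:c:]) ds"
  have "(\<Sum>a\<leftarrow>?as. degree a) = (\<Sum>i\<leftarrow>[0..<Suc j]. q ^ i)"
    by (simp add: comp_def degree_monom_eq del: upt_Suc)
  then have degs: "degree (coeff (poly_of_roots ?as) i) \<le> (\<Sum>i\<leftarrow>[0..<Suc j]. q ^ i)" for i
    using degree_coeff_poly_of_roots[of ?as i] by simp
  have "coeff_pairing idx w ([:- monom 1 (q ^ Suc j), 1:] * poly_of_roots ?as) = 0"
    using Suc.prems(1) by (simp add: ac_simps del: mult_pCons_left mult_pCons_right)
  from coeff_pairing_replace_root[OF degs deg sum_powers_lt[OF assms(1)] this]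
  have "coeff_pairing idx w ([:- [:c:], 1:] * poly_of_roots ?as) = 0" .
  then have "coeff_pairing idx w (poly_of_roots (map (\<lambda>i. monom 1 (q ^ i)) [0..<Suc j] @ map (\<lambda>c. [:c:]) (c # ds))) = 0"
    by (simp add: ac_simps del: mult_pCons_left mult_pCons_right)
  from Suc.IH[OF this cs(2)] show ?case
    by (simp add: cs(1))
qed simp

section \<open>Elements of full degree\<close>

context frobenius_extension
begin

definition full_degree :: "'e \<Rightarrow> bool" where
  "full_degree \<alpha> \<longleftrightarrow> inj_on (\<lambda>i. \<alpha> ^ (q ^ i)) {..<h}"

lemma frob_funpow: "((\<lambda>x. x ^ q) ^^ i) \<alpha> = (\<alpha> :: 'e) ^ (q ^ i)"
  by (induction i) (simp_all add: mult.commute[of q] flip: power_mult)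

lemma orbit_frob: "orbit (\<lambda>x. x ^ q) \<alpha> = (\<lambda>i. (\<alpha> :: 'e) ^ (q ^ i)) ` {..<h}"
  using orbit_altdef_bounded[of h "\<lambda>x. x ^ q" \<alpha>] h_pos by (auto simp: frob_funpow frob_h)

lemma full_degree_iff: "full_degree \<alpha> \<longleftrightarrow> card (orbit (\<lambda>x. x ^ q) \<alpha>) = h"
  unfolding full_degree_def orbit_frob using eq_card_imp_inj_on[of "{..<h}"]
  by (auto simp: card_image)

text \<open>
  Frobenius is injective, so a coincidence of two conjugates of \<open>\<alpha>\<close> moves down to a coincidence
  of \<open>\<alpha>\<close> with some \<open>\<alpha> ^ (q ^ d)\<close>, where \<open>0 < d < h\<close>.
\<close>

lemma not_full_degree_subset: "{\<alpha>. \<not> full_degree \<alpha>} \<subseteq> (\<Union>d\<in>{1..<h}. {x. x ^ (q ^ d) = x})"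
proof
  fix \<alpha> assume "\<alpha> \<in> {\<alpha>. \<not> full_degree \<alpha>}"
  then have "\<exists>i j. i < j \<and> j < h \<and> \<alpha> ^ (q ^ i) = \<alpha> ^ (q ^ j)"
    unfolding full_degree_def inj_on_def mem_Collect_eq by (metis lessThan_iff nat_neq_iff)
  then obtain i j where ij: "i < j" "j < h" "\<alpha> ^ (q ^ i) = \<alpha> ^ (q ^ j)"
    by blast
  have "(\<alpha> ^ (q ^ (j - i))) ^ (q ^ i) = \<alpha> ^ (q ^ i)"
    using ij by (simp flip: power_mult power_add)
  then have "\<alpha> ^ (q ^ (j - i)) = \<alpha>"
    by (simp add: frob_iter_inj)
  with ij(1,2) show "\<alpha> \<in> (\<Union>d\<in>{1..<h}. {x. x ^ (q ^ d) = x})"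
    by (intro UN_I[of "j - i"]) auto
qed

text \<open>
  A crude count: every exponent below \<open>h\<close> is treated like a proper divisor of \<open>h\<close>.
\<close>

lemma card_full_degree: "q ^ h \<le> card {\<alpha>. full_degree \<alpha>} + (\<Sum>d\<in>{1..<h}. q ^ d)"
proof -
  have "card {\<alpha>. \<not> full_degree \<alpha>} \<le> card (\<Union>d\<in>{1..<h}. {x :: 'e. x ^ (q ^ d) = x})"
    by (rule card_mono[OF _ not_full_degree_subset]) simp
  also have "\<dots> \<le> (\<Sum>d\<in>{1..<h}. card {x :: 'e. x ^ (q ^ d) = x})"
    by (rule card_UN_le) simp
  also have "\<dots> \<le> (\<Sum>d\<in>{1..<h}. q ^ d)"
    using q_gt_1 by (intro sum_mono card_power_eq_self_le one_less_power) auto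
  finally have "card {\<alpha>. \<not> full_degree \<alpha>} \<le> (\<Sum>d\<in>{1..<h}. q ^ d)" .
  moreover have "card {\<alpha>. full_degree \<alpha>} + card {\<alpha>. \<not> full_degree \<alpha>} = q ^ h"
    unfolding card_ext[symmetric]
    by (subst card_Un_disjoint[symmetric]) (auto intro: arg_cong[of _ _ card])
  ultimately show ?thesis
    by linarith
qed

lemma coeff_poly_of_roots_fixed:
  fixes as :: "'e list"
  assumes "\<And>a. a \<in> set as \<Longrightarrow> a ^ q = a"
  shows "coeff (poly_of_roots as) n ^ q = coeff (poly_of_roots as) n"
  using assms
proof (induction as arbitrary: n)
  case Nil
  then show ?case
    using q_gt_1 by (simp add: coeff_1)
next
  case (Cons a as)
  then show ?case
    using q_gt_1
    by (auto simp: coeff_linear_mult frob_add frob_minus power_mult_distrib diff_conv_add_uminus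
        split: nat.split simp del: mult_pCons_left add_uminus_conv_diff)
qed

end

section \<open>The moment curve\<close>

text \<open>
  Vectors over the index type are read as polynomials of degree less than \<open>h * k\<close> by means of the
  numbering \<open>idx\<close> of the coordinates.
\<close>

locale moment_curve = frobenius_extension \<iota> q h
  for \<iota> :: "'f::{field,finite} \<Rightarrow> 'e::{field,finite}" and q h :: nat +
  fixes idx :: "'n::finite \<Rightarrow> nat" and k :: nat
  assumes idx: "bij_betw idx UNIV {..<h * k}"
    and h_ge_2: "h \<ge> 2" and k_ge_2: "k \<ge> 2" and q_large: "q \<ge> h * k + 1"
begin

lemma card_idx: "CARD('n) = h * k"
  using bij_betw_same_card[OF idx] by simp

lemma idx_less: "idx i < h * k"
  using idx by (auto simp: bij_betw_def)

lemma idx_le: "idx i \<le> h * k - 1"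
  using idx_less[of i] by linarith

lemma inj_idx: "idx i = idx j \<longleftrightarrow> i = j"
  using idx by (auto simp: bij_betw_def inj_on_def)

lemma sum_idx: "(\<Sum>i\<in>UNIV. g (idx i)) = (\<Sum>m<h * k. g m)"
  by (rule sum.reindex_bij_betw[OF idx])

definition pt :: "'e \<Rightarrow> 'e ^ 'n" where
  "pt \<alpha> = (\<chi> i. \<alpha> ^ idx i)"

lemma P_pt_eq: "P_pt idx \<alpha> = vec.span {pt \<alpha>}"
  by (simp add: P_pt_def pt_def)

lemma Psi_iter_pt: "(Psi q ^^ i) (pt \<alpha>) = pt (\<alpha> ^ (q ^ i))"
  by (simp add: Psi_iter pt_def vec_eq_iff mult.commute flip: power_mult)

definition poly_of_vec :: "'a::comm_ring_1 ^ 'n \<Rightarrow> 'a poly" where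
  "poly_of_vec f = (\<Sum>i\<in>UNIV. monom (f $ i) (idx i))"

definition vec_of_poly :: "'a::comm_ring_1 poly \<Rightarrow> 'a ^ 'n" where
  "vec_of_poly p = (\<chi> i. coeff p (idx i))"

lemma degree_poly_of_vec: "degree (poly_of_vec f) \<le> h * k - 1"
  unfolding poly_of_vec_def
  by (intro degree_sum_le order.trans[OF degree_monom_le]) (use idx_le in auto)

lemma coeff_poly_of_vec: "coeff (poly_of_vec f) (idx i) = f $ i"
  by (simp add: poly_of_vec_def coeff_sum inj_idx)

lemma poly_poly_of_vec: "poly (poly_of_vec f) \<alpha> = scalar_product f (pt \<alpha>)"
  by (simp add: poly_of_vec_def poly_sum poly_monom scalar_product_def pt_def)

lemma scalar_product_vec_of_poly:
  assumes "degree p < h * k"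
  shows "scalar_product (vec_of_poly p) (pt \<alpha>) = poly p \<alpha>"
proof -
  have "scalar_product (vec_of_poly p) (pt \<alpha>) = (\<Sum>m<h * k. coeff p m * \<alpha> ^ m)"
    using sum_idx[of "\<lambda>m. coeff p m * \<alpha> ^ m"]
    by (simp add: scalar_product_def vec_of_poly_def pt_def)
  also have "\<dots> = (\<Sum>m\<le>degree p. coeff p m * \<alpha> ^ m)"
    using assms by (intro sum.mono_neutral_right) (auto simp: coeff_eq_0)
  finally show ?thesis
    by (simp add: poly_altdef)
qed

text \<open>
  A functional that vanishes at many points of the moment curve is a polynomial with too many roots.
\<close>

lemma functional_zero_of_many_roots:
  assumes "\<And>\<alpha>. \<alpha> \<in> B \<Longrightarrow> scalar_product f (pt \<alpha>) = 0" "card B \<ge> h * k"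
  shows "f = 0"
proof -
  have "h * k > 0"
    using h_ge_2 k_ge_2 by simp
  then have "card B > degree (poly_of_vec f)"
    using degree_poly_of_vec[of f] assms(2) by linarith
  then have "poly_of_vec f = 0"
    using assms(1) by (intro poly_eqI_degree[of B]) (auto simp: poly_poly_of_vec)
  then show ?thesis
    using coeff_poly_of_vec[of f] by (simp add: vec_eq_iff)
qed

text \<open>
  The polynomial with root set \<open>B\<close> is a functional that separates \<open>pt \<beta>\<close> from \<open>pt ` B\<close>.
\<close>

lemma pt_notin_span:
  assumes "\<beta> \<notin> B" "card B < h * k"
  shows "pt \<beta> \<notin> vec.span (pt ` B)"
proof
  assume \<beta>: "pt \<beta> \<in> vec.span (pt ` B)"
  obtain bs where bs: "set bs = B" "distinct bs"
    using finite_distinct_list[of B] by auto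
  have len: "length bs < h * k"
    using bs assms(2) distinct_card by force
  have "scalar_product (vec_of_poly (poly_of_roots bs)) (pt x) = poly (poly_of_roots bs) x" for x
    using len by (intro scalar_product_vec_of_poly) (simp add: degree_poly_of_roots)
  moreover from this have "scalar_product (vec_of_poly (poly_of_roots bs)) (pt \<beta>) = 0"
    using bs(1) by (intro scalar_product_zero_on_span[OF \<beta>]) (auto simp: poly_poly_of_roots_eq_0_iff)
  ultimately show False
    using assms(1) bs(1) by (simp add: poly_poly_of_roots_eq_0_iff)
qed

lemma dim_pt_image:
  assumes "card B \<le> h * k"
  shows "vec.dim (pt ` B) = card B"
proof -
  have "finite B"
    by simp
  then show ?thesis
    using assms
    by (induction B rule: finite_induct) (auto simp: vec.dim_insert pt_notin_span)
qed

lemma X_star_P_pt: "X_star q h (P_pt idx \<alpha>) = vec.span (pt ` orbit (\<lambda>x. x ^ q) \<alpha>)"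
  by (simp add: P_pt_eq X_star_point Psi_iter_pt orbit_frob image_image)

lemma proj_subspace_X_P_pt:
  assumes "full_degree \<alpha>"
  shows "proj_subspace (h - 1) (X \<iota> q h (P_pt idx \<alpha>))"
proof -
  have "h \<le> h * k"
    using k_ge_2 by simp
  then have "vec.dim (X_star q h (P_pt idx \<alpha>)) = h"
    using assms by (simp add: X_star_P_pt dim_pt_image full_degree_iff)
  then show ?thesis
    using h_pos by (simp add: proj_subspace_def subspace_X P_pt_eq dim_X)
qed

text \<open>
  The \<open>k\<close> members come from \<open>k\<close> disjoint orbits, which have \<open>h * k\<close> elements in total.  A functional
  that kills the members is a polynomial vanishing on all these elements.
\<close>

lemma pseudo_arc_P_hkq:
  assumes L: "frobenius_orbit_reps q h L"
  shows "pseudo_arc h k (P_hkq \<iota> idx q h L)"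
  unfolding pseudo_arc_def
proof (intro conjI ballI allI impI)
  show "CARD('n) = h * k"
    by (rule card_idx)
next
  fix S assume "S \<in> P_hkq \<iota> idx q h L"
  then obtain \<alpha> where \<alpha>: "\<alpha> \<in> L" "S = X \<iota> q h (P_pt idx \<alpha>)"
    by (auto simp: P_hkq_def)
  then have "full_degree \<alpha>"
    using L by (simp add: frobenius_orbit_reps_def full_degree_iff)
  then show "proj_subspace (h - 1) S"
    unfolding \<alpha>(2) by (rule proj_subspace_X_P_pt)
next
  fix \<B> assume \<B>: "\<B> \<subseteq> P_hkq \<iota> idx q h L \<and> card \<B> = k"
  then have "\<forall>S\<in>\<B>. \<exists>\<alpha>\<in>L. S = X \<iota> q h (P_pt idx \<alpha>)"
    by (auto simp: P_hkq_def)
  then obtain r where r: "\<And>S. S \<in> \<B> \<Longrightarrow> r S \<in> L \<and> S = X \<iota> q h (P_pt idx (r S))"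
    by metis
  define orb where "orb \<alpha> = orbit (\<lambda>x :: 'e. x ^ q) \<alpha>" for \<alpha>
  have card_orb: "card (orb (r S)) = h" if "S \<in> \<B>" for S
    using r[OF that] L by (auto simp: frobenius_orbit_reps_def orb_def)
  have self: "\<alpha> \<in> orb \<alpha>" for \<alpha>
    unfolding orb_def orbit_frob using h_pos by (intro image_eqI[of _ _ 0]) auto
  have disj: "orb (r S) \<inter> orb (r T) = {}" if "S \<in> \<B>" "T \<in> \<B>" "S \<noteq> T" for S T
  proof (rule ccontr)
    assume "orb (r S) \<inter> orb (r T) \<noteq> {}"
    then obtain x where x: "x \<in> orb (r S)" "x \<in> orb (r T)"
      by blast
    have swap: "r S \<in> orb x" "r T \<in> orb x"
      using x self unfolding orb_def by (blast intro: orbit_swap)+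
    have "orb x = orb (r S)"
      using x(1) swap(1) unfolding orb_def by (blast intro: orbit_trans)
    then have "card (orb x) = h"
      using card_orb that(1) by simp
    then have "r S = r T"
      using L swap r that(1,2) unfolding frobenius_orbit_reps_def orb_def by blast
    then show False
      using r that by metis
  qed
  have fin: "finite \<B>"
    using \<B> k_ge_2 by (intro card_ge_0_finite) simp
  have "card (\<Union>S\<in>\<B>. orb (r S)) = (\<Sum>S\<in>\<B>. card (orb (r S)))"
    using fin disj by (intro card_UN_disjoint) auto
  also have "\<dots> = h * k"
    using card_orb \<B> by (simp add: mult.commute)
  finally have card: "card (\<Union>S\<in>\<B>. orb (r S)) = h * k" .
  show "vec.span (\<Union>\<B>) = UNIV"
  proof (rule ccontr)
    assume "vec.span (\<Union>\<B>) \<noteq> UNIV"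
    then obtain x where "x \<notin> vec.span (\<Union>\<B>)"
      by blast
    then obtain f where f: "\<And>s. s \<in> \<Union>\<B> \<Longrightarrow> scalar_product f s = 0" "scalar_product f x \<noteq> 0"
      using separating_functional by blast
    have "scalar_product (embed_vec \<iota> f) (pt \<alpha>) = 0" if \<alpha>: "\<alpha> \<in> (\<Union>S\<in>\<B>. orb (r S))" for \<alpha>
    proof -
      obtain S where S: "S \<in> \<B>" "\<alpha> \<in> orb (r S)"
        using \<alpha> by blast
      then have fS: "scalar_product f s = 0" if "s \<in> S" for s
        using f(1) that by blast
      have "pt \<alpha> \<in> X_star q h (P_pt idx (r S))"
        unfolding X_star_P_pt using S(2) by (intro vec.span_base) (simp add: orb_def)
      also have "\<dots> = vec.span (embed_vec \<iota> ` S)"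
        using r[OF S(1)] span_embed_X by (metis P_pt_eq)
      finally show ?thesis
        by (rule scalar_product_zero_on_span)
           (use fS in \<open>auto simp: scalar_product_embed_vec\<close>)
    qed
    then have "embed_vec \<iota> f = 0"
      by (rule functional_zero_of_many_roots[OF _ eq_refl[OF card[symmetric]]])
    then have "f = 0"
      using inj_embed_vec[THEN injD, of f 0] by (simp add: embed_vec_0)
    then show False
      using f(2) by (simp add: scalar_product_def)
  qed
qed

section \<open>Maps preserving the conjugate spans\<close>

text \<open>
  At \<open>Y = \<alpha>\<close> the pairing is the product of \<open>M *v pt \<alpha>\<close> with a polynomial that vanishes at all
  conjugates of \<open>\<alpha>\<close>, hence zero.  The pairing has degree at most \<open>1 + q + \<dots> + q ^ (h - 1) + (h * k - 1)\<close>
  in \<open>Y\<close>, and there are more elements of full degree than that.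
\<close>

lemma pairing_vanishes_of_invariant:
  fixes M :: "'e ^ 'n ^ 'n"
  assumes inv: "\<And>\<alpha>. full_degree \<alpha> \<Longrightarrow> M *v pt \<alpha> \<in> X_star q h (P_pt idx \<alpha>)"
    and len: "length ds + h < h * k"
  shows "coeff_pairing idx (\<lambda>j. poly_of_vec (M $ j))
    (poly_of_roots (map (\<lambda>i. monom 1 (q ^ i)) [0..<h] @ map (\<lambda>c. [:c:]) ds)) = 0" (is "?R = 0")
proof -
  let ?as = "map (\<lambda>i. monom 1 (q ^ i)) [0..<h] @ map (\<lambda>c. [:c:]) ds"
  have zero: "poly ?R \<alpha> = 0" if \<alpha>: "full_degree \<alpha>" for \<alpha>
  proof -
    define f where "f = poly_of_roots (map (\<lambda>i. \<alpha> ^ (q ^ i)) [0..<h] @ ds)"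
    have "poly ?R \<alpha> = (\<Sum>j\<in>UNIV. coeff f (idx j) * scalar_product (M $ j) (pt \<alpha>))"
      by (simp only: coeff_pairing_def poly_sum poly_mult poly_coeff_poly_of_roots poly_poly_of_vec)
         (simp add: f_def comp_def poly_monom)
    also have "\<dots> = scalar_product (vec_of_poly f) (M *v pt \<alpha>)"
      by (simp add: scalar_product_def vec_of_poly_def matrix_vector_mult_def)
    also have "\<dots> = 0"
    proof (rule scalar_product_zero_on_span)
      show "M *v pt \<alpha> \<in> vec.span (pt ` orbit (\<lambda>x. x ^ q) \<alpha>)"
        using inv[OF \<alpha>] by (simp add: X_star_P_pt)
      fix s assume "s \<in> pt ` orbit (\<lambda>x. x ^ q) \<alpha>"
      then obtain \<beta> where \<beta>: "s = pt \<beta>" "\<beta> \<in> orbit (\<lambda>x. x ^ q) \<alpha>"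
        by blast
      have "degree f < h * k"
        using len by (simp only: f_def degree_poly_of_roots) simp
      moreover have "poly f \<beta> = 0"
        using \<beta>(2) by (auto simp: f_def poly_poly_of_roots_eq_0_iff orbit_frob simp del: poly_of_roots_simps)
      ultimately show "scalar_product (vec_of_poly f) s = 0"
        by (simp add: \<beta>(1) scalar_product_vec_of_poly)
    qed
    finally show ?thesis .
  qed
  \<comment> \<open>The geometric sum exceeds by one the bound for the number of elements that are not of full degree.\<close>
  define G where "G = (\<Sum>i<h. q ^ i)"
  have "(\<Sum>a\<leftarrow>?as. degree a) = G"
    by (simp add: comp_def degree_monom_eq G_def interv_sum_list_conv_sum_set_nat atLeast0LessThan)
  then have degR: "degree ?R \<le> G + (h * k - 1)"
    using degree_coeff_poly_of_roots[of ?as] degree_poly_of_vec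
    by (intro degree_coeff_pairing) auto
  have G1: "G = 1 + (\<Sum>i\<in>{1..<h}. q ^ i)"
    unfolding G_def lessThan_atLeast0 using h_pos by (subst sum.atLeast_Suc_lessThan) simp_all
  \<comment> \<open>The count needs three times the geometric sum to be less than \<open>q ^ h\<close>; this follows from \<open>q \<ge> 5\<close>.\<close>
  have "q ^ 1 \<le> (\<Sum>i\<in>{1..<h}. q ^ i)"
    using h_ge_2 by (intro member_le_sum) auto
  then have G2: "G \<ge> 1 + q"
    using G1 by simp
  have "2 * 2 \<le> h * k"
    using h_ge_2 k_ge_2 by (intro mult_le_mono) auto
  then have "q \<ge> 5"
    using q_large by simp
  have "q * (\<Sum>i<n. q ^ i) + 1 = (\<Sum>i<n. q ^ i) + q ^ n" for n
    by (induction n) (simp_all add: algebra_simps)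
  then have "q * G + 1 = G + q ^ h"
    by (simp only: G_def)
  moreover have "5 * G \<le> q * G"
    using \<open>q \<ge> 5\<close> by (rule mult_le_mono1)
  ultimately have "q ^ h > 3 * G"
    by linarith
  then have "G + (h * k - 1) < card {\<alpha>. full_degree \<alpha>}"
    using card_full_degree G1 G2 q_large by linarith
  with degR show ?thesis
    using zero by (intro poly_eqI_degree[of "{\<alpha>. full_degree \<alpha>}"]) auto
qed

text \<open>
  The polynomial \<open>T\<close> that belongs to the product of \<open>f\<close> with \<open>M\<close> vanishes at each root \<open>a\<close> of \<open>f\<close>: in the
  vanishing pairing \<open>h - 1\<close> roots are specialized to further roots of \<open>f\<close>, the remaining roots of \<open>f\<close> are
  built in as constants, and \<open>Y\<close> is set to \<open>a\<close>.  Both \<open>T\<close> and \<open>f\<close> have degree at most \<open>h * k - 1\<close>, the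
  number of the roots, so they are proportional.
\<close>

lemma left_eigenvector_of_invariant:
  fixes M :: "'e ^ 'n ^ 'n"
  assumes inv: "\<And>\<alpha>. full_degree \<alpha> \<Longrightarrow> M *v pt \<alpha> \<in> X_star q h (P_pt idx \<alpha>)"
    and xs: "distinct xs" "length xs = h * k - 1"
  obtains l where "vec_of_poly (poly_of_roots xs) v* M = l *s vec_of_poly (poly_of_roots xs)"
proof -
  define f where "f = poly_of_roots xs"
  define w where "w j = poly_of_vec (M $ j)" for j
  define T where "T = poly_of_vec (vec_of_poly f v* M)"
  have deg_w: "degree (w j) \<le> q - 2" for j
    using degree_poly_of_vec[of "M $ j"] q_large unfolding w_def by linarith
  have polyT: "poly T a = (\<Sum>j\<in>UNIV. coeff f (idx j) * poly (w j) a)" for a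
    by (simp only: T_def w_def poly_poly_of_vec scalar_product_vector_matrix)
       (simp add: scalar_product_def vec_of_poly_def matrix_vector_mult_def)
  \<comment> \<open>For \<open>k \<ge> 2\<close> there are at least \<open>h\<close> roots: one for \<open>Y\<close> and \<open>h - 1\<close> for the other powers.\<close>
  have "2 * h \<le> h * k"
    using k_ge_2 by simp
  have T0: "poly T a = 0" if "a \<in> set xs" for a
  proof -
    define cs ds where "cs = take (h - 1) (remove1 a xs)" and "ds = drop (h - 1) (remove1 a xs)"
    have len: "length (remove1 a xs) = h * k - 2"
      using that xs(2) by (simp add: length_remove1)
    have "length cs = min (h * k - 2) (h - 1)" "length ds = h * k - 2 - (h - 1)"
      by (simp_all only: cs_def ds_def length_take length_drop len)
    then have lens: "length cs = h - 1" "length ds + h < h * k"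
      using \<open>2 * h \<le> h * k\<close> h_ge_2 by linarith+
    have "coeff_pairing idx w (poly_of_roots (map (\<lambda>i. monom 1 (q ^ i)) [0..<Suc (h - 1)] @ map (\<lambda>c. [:c:]) ds)) = 0"
      using pairing_vanishes_of_invariant[OF inv lens(2)] h_pos by (simp add: w_def[abs_def])
    then have "coeff_pairing idx w (poly_of_roots (monom 1 1 # map (\<lambda>c. [:c:]) (cs @ ds))) = 0"
      using q_gt_1 deg_w lens(1) by (intro coeff_pairing_specialize[of q w idx "h - 1"]) auto
    then have "poly (coeff_pairing idx w (poly_of_roots (monom 1 1 # map (\<lambda>c. [:c:]) (cs @ ds)))) a = 0"
      by simp
    then have "(\<Sum>j\<in>UNIV. coeff (poly_of_roots (a # cs @ ds)) (idx j) * poly (w j) a) = 0"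
      by (simp only: coeff_pairing_def poly_sum poly_mult poly_coeff_poly_of_roots)
         (simp add: comp_def poly_monom del: poly_of_roots_simps)
    moreover have "poly_of_roots (a # cs @ ds) = f"
      using poly_of_roots_remove1[OF that] by (simp add: f_def cs_def ds_def del: poly_of_roots_simps)
    ultimately show ?thesis
      by (simp only: polyT)
  qed
  define l where "l = coeff T (h * k - 1)"
  have "T = smult l f"
  proof (rule poly_eqI_degree_lead_coeff)
    show "coeff T (h * k - 1) = coeff (smult l f) (h * k - 1)"
      using lead_coeff_poly_of_roots[of xs] xs(2) by (simp add: f_def l_def)
    show "h * k - 1 \<le> card (set xs)"
      using xs by (simp add: distinct_card)
    show "degree T \<le> h * k - 1"
      unfolding T_def by (rule degree_poly_of_vec)
    show "degree (smult l f) \<le> h * k - 1"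
      using xs(2) by (intro order.trans[OF degree_smult_le]) (simp add: f_def degree_poly_of_roots)
    show "poly T z = poly (smult l f) z" if "z \<in> set xs" for z
      using T0[OF that] that by (simp add: f_def poly_poly_of_roots_eq_0_iff)
  qed
  then have "(vec_of_poly f v* M) $ i = (l *s vec_of_poly f) $ i" for i
    using coeff_poly_of_vec[of "vec_of_poly f v* M" i] by (simp add: T_def vec_of_poly_def)
  then show ?thesis
    using that[of l] by (simp add: f_def vec_eq_iff)
qed

section \<open>Desarguesian spreads\<close>

text \<open>
  The conjugates of a basis \<open>B\<close> of \<open>\<Theta>\<close> span the space and are at most \<open>h * k\<close> many, so they are
  distinct and form a basis, on which \<open>M\<close> can be prescribed: it fixes \<open>B\<close> and kills the rest.
\<close>

lemma conjugate_projection: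
  fixes \<Theta> :: "('e ^ 'n) set"
  assumes \<Theta>: "vec.subspace \<Theta>" "vec.dim \<Theta> = k" "conj_span q h \<Theta> = UNIV"
  obtains M :: "'e ^ 'n ^ 'n" where "\<And>x. x \<in> \<Theta> \<Longrightarrow> M *v x = x"
    and "\<And>i x. \<lbrakk>0 < i; i < h; x \<in> \<Theta>\<rbrakk> \<Longrightarrow> M *v (Psi q ^^ i) x = 0"
proof -
  obtain B where B: "B \<subseteq> \<Theta>" "vec.independent B" "\<Theta> \<subseteq> vec.span B" "card B = k"
    using vec.basis_exists[of \<Theta>] \<Theta>(2) by metis
  have spanB: "vec.span B = \<Theta>"
    using B(1,3) \<Theta>(1) by (simp add: subset_antisym vec.span_minimal)
  define g where "g = (\<lambda>(i, b :: 'e ^ 'n). (Psi q ^^ i) b)"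
  define C where "C = g ` ({..<h} \<times> B)"
  have C_alt: "C = (\<Union>i<h. (Psi q ^^ i) ` B)"
    by (auto simp: C_def g_def)
  have finB: "finite B"
    using B(2) by (rule vec.finiteI_independent)
  have spanC: "vec.span C = UNIV"
    using \<Theta>(3) conj_span_span[of B] by (simp add: spanB C_alt conj_span_def)
  have "card C \<le> h * k"
    unfolding C_def using card_image_le[of "{..<h} \<times> B" g] finB B(4) by (simp add: card_cartesian_product)
  moreover have "h * k \<le> card C"
    using vec.dim_le_card[of UNIV C] spanC finB by (simp add: C_def card_cart_basis card_idx)
  ultimately have cardC: "card C = h * k"
    by (rule antisym)
  have indC: "vec.independent C"
    using finB spanC cardC
    by (intro vec.card_le_dim_spanning[of C UNIV]) (auto simp: C_def card_cart_basis card_idx)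
  have inj: "inj_on g ({..<h} \<times> B)"
    using cardC finB B(4) by (intro eq_card_imp_inj_on) (simp_all add: C_def card_cartesian_product)
  obtain F :: "'e ^ 'n \<Rightarrow> 'e ^ 'n" where F: "Vector_Spaces.linear (*s) (*s) F"
    "\<forall>c\<in>C. F c = (if c \<in> B then c else 0)"
    using vec.linear_independent_extend[OF indC, of "\<lambda>c. if c \<in> B then c else 0"] by blast
  have M: "matrix F *v x = F x" for x
    using matrix_works[OF F(1)] by simp
  interpret F: Vector_Spaces.linear "(*s)" "(*s)" F
    by (rule F(1))
  have "F x = x" if "x \<in> \<Theta>" for x
  proof -
    have "F b = b" if "b \<in> B" for b
    proof -
      have "b \<in> C"
        unfolding C_alt using that h_pos by (intro UN_I[of 0]) auto
      then show ?thesis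
        using F(2) that by simp
    qed
    then show ?thesis
      using that vec.linear_eq_on_span[OF F(1) vec.linear_id, of B] B(3) by auto
  qed
  moreover have "F ((Psi q ^^ i) x) = 0" if i: "0 < i" "i < h" and x: "x \<in> \<Theta>" for i x
  proof -
    have "F ((Psi q ^^ i) b) = 0" if "b \<in> B" for b
    proof -
      have "(Psi q ^^ i) b \<notin> B"
      proof
        assume "(Psi q ^^ i) b \<in> B"
        moreover have "g (i, b) = g (0, (Psi q ^^ i) b)"
          by (simp add: g_def)
        ultimately have "(i, b) = (0, (Psi q ^^ i) b)"
          using that i by (intro inj_onD[OF inj]) auto
        then show False
          using i by simp
      qed
      moreover have "(Psi q ^^ i) b \<in> C"
        using that i by (auto simp: C_alt)
      ultimately show ?thesis
        using F(2) by simp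
    qed
    moreover have "(Psi q ^^ i) x \<in> vec.span ((Psi q ^^ i) ` B)"
      using x B(3) by (intro Psi_iter_span) blast
    ultimately show ?thesis
      using F.eq_0_on_span[of "(Psi q ^^ i) ` B"] by blast
  qed
  ultimately show ?thesis
    using that[of "matrix F"] by (simp add: M)
qed

text \<open>
  The projection \<open>M\<close> onto \<open>\<Theta>\<close> along its other conjugates would have a left eigenvector \<open>f \<noteq> 0\<close> that is fixed by
  Frobenius.  It would annihilate \<open>\<Theta>\<close> or the first conjugate of \<open>\<Theta>\<close>, depending on the eigenvalue, and
  then all conjugates.
\<close>

lemma no_transversal_subspace:
  fixes \<Theta> :: "('e ^ 'n) set"
  assumes \<Theta>: "vec.subspace \<Theta>" "vec.dim \<Theta> = k" "conj_span q h \<Theta> = UNIV"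
    and trans: "\<And>\<alpha>. full_degree \<alpha> \<Longrightarrow> \<exists>w\<in>\<Theta>. X_star q h (P_pt idx \<alpha>) = X_star q h (vec.span {w})"
  shows False
proof -
  obtain M :: "'e ^ 'n ^ 'n" where M: "\<And>x. x \<in> \<Theta> \<Longrightarrow> M *v x = x"
    "\<And>i x. \<lbrakk>0 < i; i < h; x \<in> \<Theta>\<rbrakk> \<Longrightarrow> M *v (Psi q ^^ i) x = 0"
    using conjugate_projection[OF \<Theta>] by blast
  have inv: "M *v pt \<alpha> \<in> X_star q h (P_pt idx \<alpha>)" if \<alpha>: "full_degree \<alpha>" for \<alpha>
  proof -
    obtain w where w: "w \<in> \<Theta>" "X_star q h (P_pt idx \<alpha>) = X_star q h (vec.span {w})"
      using trans[OF \<alpha>] by blast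
    let ?W = "(\<lambda>i. (Psi q ^^ i) w) ` {..<h}"
    have W: "X_star q h (P_pt idx \<alpha>) = vec.span ?W"
      by (simp add: w(2) X_star_point)
    have "pt \<alpha> \<in> vec.span ?W"
      unfolding W[symmetric] X_star_P_pt orbit_frob using h_pos
      by (intro vec.span_base image_eqI[of _ _ \<alpha>] image_eqI[of _ _ 0]) auto
    then have "M *v pt \<alpha> \<in> vec.span ((*v) M ` ?W)"
      using vec.linear_span_image[OF matrix_vector_mul_linear_gen, of M ?W] by blast
    moreover have "(*v) M ` ?W \<subseteq> vec.span ?W"
    proof -
      have "M *v (Psi q ^^ i) w \<in> vec.span ?W" if "i < h" for i
      proof (cases "i = 0")
        case True
        have "w \<in> ?W"
          using h_pos by (intro image_eqI[of _ _ 0]) auto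
        then show ?thesis
          using True M(1) w(1) by (simp add: vec.span_base)
      next
        case False
        then show ?thesis
          using M(2) w(1) that by (simp add: vec.span_zero)
      qed
      then show ?thesis
        by blast
    qed
    ultimately show ?thesis
      unfolding W using vec.span_minimal[OF _ vec.subspace_span] by blast
  qed
  have "h * k - 1 \<le> card (range \<iota>)"
    using q_large inj_embed by (simp add: card_image card_base)
  then obtain R where R: "R \<subseteq> range \<iota>" "card R = h * k - 1"
    by (meson obtain_subset_with_card_n)
  obtain xs where xs: "set xs = R" "distinct xs"
    using finite_distinct_list[of R] by auto
  have len: "length xs = h * k - 1"
    using xs R(2) distinct_card by force
  define f where "f = vec_of_poly (poly_of_roots xs)"
  obtain l where l: "f v* M = l *s f"
    using left_eigenvector_of_invariant[OF inv xs(2) len] unfolding f_def by blast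
  have "coeff (poly_of_roots xs) n ^ q = coeff (poly_of_roots xs) n" for n
    using R(1) xs(1) fixed_iff_range by (intro coeff_poly_of_roots_fixed) blast
  then have "Psi q f = f"
    by (simp add: f_def vec_of_poly_def Psi_def vec_eq_iff)
  then have conj1: "scalar_product f (Psi q x) = scalar_product f x ^ q" for x
    using scalar_product_Psi[of f x] by simp
  have conj: "scalar_product f ((Psi q ^^ i) x) = scalar_product f x ^ (q ^ i)" for i x
    by (induction i) (simp_all add: conj1 mult.commute[of q] flip: power_mult)
  have eig: "l * scalar_product f x = scalar_product f (M *v x)" for x
    by (metis l scalar_product_scale_left scalar_product_vector_matrix)
  have zero: "scalar_product f x = 0" if "x \<in> \<Theta>" for x
  proof (cases "l = 0")
    case True
    then show ?thesis
      using eig[of x] M(1)[OF that] by simp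
  next
    case False
    have "scalar_product f ((Psi q ^^ 1) x) = 0"
      using eig[of "(Psi q ^^ 1) x"] M(2)[of 1 x] that h_ge_2 False by simp
    then show ?thesis
      using conj[of 1 x] by simp
  qed
  have "scalar_product f y = 0" for y
  proof (rule scalar_product_zero_on_span)
    show "y \<in> vec.span (\<Union>i<h. (Psi q ^^ i) ` \<Theta>)"
      using \<Theta>(3) by (simp add: conj_span_def)
    show "scalar_product f s = 0" if "s \<in> (\<Union>i<h. (Psi q ^^ i) ` \<Theta>)" for s
      using that zero q_gt_1 by (auto simp: conj)
  qed
  then have "f = 0"
    by (rule scalar_product_nondegenerate)
  moreover obtain i where "idx i = h * k - 1"
  proof -
    have "h * k - 1 \<in> range idx"
      using idx h_ge_2 k_ge_2 by (auto simp: bij_betw_def)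
    then show ?thesis
      using that by auto
  qed
  then have "f $ i = 1"
    using lead_coeff_poly_of_roots[of xs] by (simp add: f_def vec_of_poly_def len)
  ultimately show False
    by simp
qed

text \<open>
  The matrix \<open>A\<close> is absorbed into \<open>\<Theta>\<close>.  Members given by the representatives \<open>L\<close> take care of all
  \<open>\<alpha>\<close> of full degree, because conjugate elements have the same space \<open>X_star\<close>.
\<close>

lemma not_contained_in_desarguesian_spread:
  assumes L: "frobenius_orbit_reps q h L"
    and \<D>: "desarguesian_spread \<iota> q h k \<D>"
  shows "\<not> P_hkq \<iota> idx q h L \<subseteq> \<D>"
proof
  assume sub: "P_hkq \<iota> idx q h L \<subseteq> \<D>"
  obtain \<Theta> :: "('e ^ 'n) set" and A :: "'f ^ 'n ^ 'n" where
    \<Theta>: "vec.subspace \<Theta>" "vec.dim \<Theta> = k" "conj_span q h \<Theta> = UNIV"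
    and A: "invertible A" and \<D>_eq: "\<D> = (\<lambda>S. (*v) A ` S) ` D_spread \<iota> q h \<Theta>"
    using \<D> k_ge_2 unfolding desarguesian_spread_def proj_subspace_def by auto
  \<comment> \<open>The extension of \<open>A\<close> to the large space commutes with \<open>Psi q\<close>, so it carries the spread of \<open>\<Theta>\<close> to that of the image of \<open>\<Theta>\<close>.\<close>
  define A' :: "'e ^ 'n ^ 'n" where "A' = (\<chi> i. embed_vec \<iota> (A $ i))"
  have A'_embed: "A' *v embed_vec \<iota> x = embed_vec \<iota> (A *v x)" for x
    by (simp add: A'_def embed_vec_def matrix_vector_mult_def vec_eq_iff embed_sum embed_mult)
  have base_fixed: "\<iota> a ^ q = \<iota> a" for a
    using fixed_iff_range by blast
  have A'_Psi: "A' *v Psi q x = Psi q (A' *v x)" for x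
    using base_fixed
    by (simp add: A'_def Psi_def embed_vec_def matrix_vector_mult_def vec_eq_iff frob_sum power_mult_distrib)
  have A'_Psi_iter: "A' *v (Psi q ^^ i) x = (Psi q ^^ i) (A' *v x)" for i x
    by (induction i) (simp_all add: A'_Psi)
  have lin: "Vector_Spaces.linear (*s) (*s) ((*v) A')"
    by simp
  have A'_span: "(*v) A' ` vec.span S = vec.span ((*v) A' ` S)" for S
    using vec.linear_span_image[OF lin] by simp
  have surjA: "surj ((*v) A)"
    using A by (metis invertible_right_inverse matrix_right_invertible_surjective)
  have "surj ((*v) A')"
  proof -
    have "range (embed_vec \<iota>) \<subseteq> range ((*v) A')"
      using surjA A'_embed by (metis rangeI image_subsetI surjD)
    then have "vec.span (range (embed_vec \<iota>)) \<subseteq> range ((*v) A')"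
      using A'_span[of UNIV] by (metis vec.span_mono vec.span_UNIV vec.span_span)
    moreover have "vec.dim (range (embed_vec \<iota>) :: ('e ^ 'n) set) = CARD('n)"
      by (simp only: dim_embed_vec vec_dim_card)
    then have "vec.span (range (embed_vec \<iota>) :: ('e ^ 'n) set) = UNIV"
      using vec.dim_eq_full[of "range (embed_vec \<iota>) :: ('e ^ 'n) set"]
      by (simp add: vec.dimension_def card_cart_basis)
    ultimately show ?thesis
      by auto
  qed
  then have injA': "inj ((*v) A')"
    using vec.linear_surjective_imp_injective[OF lin] by simp
  define \<Theta>' where "\<Theta>' = (*v) A' ` \<Theta>"
  have \<Theta>': "vec.subspace \<Theta>'" "vec.dim \<Theta>' = k" "conj_span q h \<Theta>' = UNIV"
  proof -
    show "vec.subspace \<Theta>'"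
      unfolding \<Theta>'_def using \<Theta>(1) lin by (rule vec.linear_subspace_image[rotated])
    show "vec.dim \<Theta>' = k"
      unfolding \<Theta>'_def using vec.dim_image_eq[OF lin, of \<Theta>] injA' \<Theta>(2) by (metis inj_on_subset subset_UNIV)
    have "(\<Union>i<h. (Psi q ^^ i) ` \<Theta>') = (*v) A' ` (\<Union>i<h. (Psi q ^^ i) ` \<Theta>)"
      by (simp add: \<Theta>'_def image_UN image_image A'_Psi_iter)
    then show "conj_span q h \<Theta>' = UNIV"
      using \<Theta>(3) \<open>surj ((*v) A')\<close> by (simp add: conj_span_def flip: A'_span)
  qed
  have "\<exists>w\<in>\<Theta>'. X_star q h (P_pt idx \<alpha>) = X_star q h (vec.span {w})" if \<alpha>: "full_degree \<alpha>" for \<alpha>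
  proof -
    obtain \<beta> where \<beta>: "\<beta> \<in> L" "\<beta> \<in> orbit (\<lambda>x. x ^ q) \<alpha>"
      using L \<alpha> unfolding frobenius_orbit_reps_def full_degree_iff by blast
    obtain j where "\<beta> = \<alpha> ^ (q ^ j)"
      using \<beta>(2) by (auto simp: orbit_frob)
    then have X\<alpha>: "X_star q h (P_pt idx \<alpha>) = X_star q h (P_pt idx \<beta>)"
      by (simp add: P_pt_eq X_star_Psi_iter flip: Psi_iter_pt)
    have "X \<iota> q h (P_pt idx \<beta>) \<in> \<D>"
      using sub \<beta>(1) by (auto simp: P_hkq_def)
    then obtain Q where Q: "proj_point Q" "Q \<subseteq> \<Theta>"
      "X \<iota> q h (P_pt idx \<beta>) = (*v) A ` X \<iota> q h Q"
      unfolding \<D>_eq D_spread_def by auto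
    obtain w where w: "w \<in> \<Theta>" "Q = vec.span {w}"
    proof -
      obtain B where B: "B \<subseteq> Q" "Q \<subseteq> vec.span B" "card B = 1"
        using vec.basis_exists[of Q] Q(1) by (metis proj_subspace_def add_0)
      then obtain w where "B = {w}"
        by (auto simp: card_1_singleton_iff)
      moreover have "vec.span B = Q"
        using B Q(1) by (simp add: proj_subspace_def subset_antisym vec.span_minimal)
      ultimately show ?thesis
        using that[of w] B(1) Q(2) by auto
    qed
    have "X_star q h (P_pt idx \<beta>) = vec.span (embed_vec \<iota> ` (*v) A ` X \<iota> q h Q)"
      by (metis P_pt_eq Q(3) span_embed_X)
    also have "embed_vec \<iota> ` (*v) A ` X \<iota> q h Q = (*v) A' ` embed_vec \<iota> ` X \<iota> q h Q"
      by (simp add: image_image A'_embed)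
    also have "vec.span \<dots> = (*v) A' ` X_star q h Q"
      by (simp add: w(2) span_embed_X flip: A'_span)
    also have "\<dots> = X_star q h (vec.span {A' *v w})"
      by (simp add: w(2) X_star_point A'_span image_image A'_Psi_iter)
    finally show ?thesis
      using w(1) X\<alpha> by (auto simp: \<Theta>'_def)
  qed
  then show False
    using no_transversal_subspace[OF \<Theta>'] by blast
qed

end

theorem theorem3p10:
  fixes h k q :: nat
    and \<iota> :: "'f::{field,finite} \<Rightarrow> 'e::{field,finite}"
    and idx :: "'n::finite \<Rightarrow> nat"
    and L :: "'e set"
  assumes "h \<ge> 2" and "k \<ge> 2"
    and "primepow q" and "q \<ge> h * k + 1"
    and "CARD('f) = q" and "CARD('e) = q ^ h" and "field_embedding \<iota>"
    and "bij_betw idx UNIV {..<h * k}"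
    and "frobenius_orbit_reps q h L"
  shows "pseudo_arc h k (P_hkq \<iota> idx q h L) \<and>
    \<not> (\<exists>\<D>. desarguesian_spread \<iota> q h k \<D> \<and> P_hkq \<iota> idx q h L \<subseteq> \<D>)"
proof -
  interpret moment_curve \<iota> q h idx k
    by unfold_locales (fact assms | use assms(1) in linarith)+
  show ?thesis
    using pseudo_arc_P_hkq not_contained_in_desarguesian_spread assms(9) by blast
qed

end
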